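(* Let $n\ge1$, $V=\{1,\dots,n\}$, let $f:2^V\to\mathbb R_+$ be a non-decreasing submodular function with $f(\emptyset)=0$, and let $\mathbf a,\mathbf b\in\mathbb R^n$ have positive entries with $a_1\le\cdots\le a_n$ and $b_1\ge\cdots\ge b_n$. In the zero-sum game in which Player 1 (maximizer) chooses $\mathbf x\in\mathcal B(f)$, Player 2 (minimizer) chooses $\mathbf y\in\Delta(\mathbf a)+\Delta(\mathbf b)$, and the payoff is $\mathbf x^T\mathbf y$, there is an optimal strategy $\mathbf y$ for Player 2 such that $$a_m\sum_{i=1}^m\frac{y_i}{a_i}+b_m\sum_{i=m+1}^n\frac{y_i}{b_i}=a_m+b_m$$ for at least one $m\in V$.
   Context: $\mathcal B(f)=\{\mathbf x\in\mathbb R^n_+:\ \mathbf x(S)\le f(S)\ \text{for all } S\subseteq V,\ \mathbf x(V)=f(V)\}$ with $\mathbf x(S)=\sum_{i\in S}x_i$ is the base of the polymatroid associated with $f$. For $\mathbf w\in\mathbb R^n_+$, $\Delta(\mathbf w)=\{\sum_{i=1}^n\theta_iw_i\mathbf e^i:\ \theta_i\ge0,\ \sum_i\theta_i=1\}$, where $\mathbf e^i$ is the $i$-th standard unit vector, and $\Delta(\mathbf a)+\Delta(\mathbf b)$ is the Minkowski sum. A strategy $\mathbf y$ of Player 2 is optimal if it attains $\min_{\mathbf y\in\Delta(\mathbf a)+\Delta(\mathbf b)}\max_{\mathbf x\in\mathcal B(f)}\mathbf x^T\mathbf y$. *)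

theory Defs
  imports "HOL-Analysis.Analysis"
begin

text \<open>
  The ground set $V = \{1,\dots,n\}$ is a finite, linearly ordered index type \<open>'n\<close> with
  \<open>CARD('n) = n\<close> (so \<open>V = UNIV\<close>, and $n \ge 1$ because types are nonempty); set functions
  have type \<open>'n set \<Rightarrow> real\<close>, and vectors in $R^n$ have type \<open>real ^ 'n\<close>.
\<close>

definition submodular :: "('n set \<Rightarrow> real) \<Rightarrow> bool" where
  "submodular f \<longleftrightarrow> (\<forall>S T. f (S \<union> T) + f (S \<inter> T) \<le> f S + f T)"

definition polymatroid_base :: "('n set \<Rightarrow> real) \<Rightarrow> (real ^ 'n::finite) set" where
  "polymatroid_base f =
    {x. (\<forall>i. 0 \<le> x $ i) \<and> (\<forall>S. (\<Sum>i\<in>S. x $ i) \<le> f S) \<and> (\<Sum>i\<in>UNIV. x $ i) = f UNIV}"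

definition weighted_simplex :: "real ^ 'n::finite \<Rightarrow> (real ^ 'n) set" where
  "weighted_simplex w =
    {(\<Sum>i\<in>UNIV. (\<theta> i * w $ i) *\<^sub>R axis i 1) | \<theta>. (\<forall>i. 0 \<le> \<theta> i) \<and> (\<Sum>i\<in>UNIV. \<theta> i) = 1}"

text \<open>
  In the bilinear zero-sum game with strategy sets \<open>X\<close> (maximizer) and \<open>Y\<close> (minimizer),
  a minimizer strategy is optimal if it attains $\min_{y \in Y} \max_{x \in X} x^T y$.
  The supremum is a maximum whenever \<open>X\<close> is compact and nonempty, as is the base of a polymatroid.
\<close>

definition optimal_minimizer ::
    "'a::euclidean_space set \<Rightarrow> 'a set \<Rightarrow> 'a \<Rightarrow> bool" where
  "optimal_minimizer X Y y \<longleftrightarrow>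
    y \<in> Y \<and> (\<forall>y'\<in>Y. (SUP x\<in>X. x \<bullet> y) \<le> (SUP x\<in>X. x \<bullet> y'))"

end

theory Submission
  imports Defs
begin

text \<open>
  If Player 2 puts weight on \<open>a\<^sub>j\<close> and on \<open>b\<^sub>i\<close> for some \<open>i < j\<close>, then, since
  \<open>a\<^sub>i / b\<^sub>i \<le> a\<^sub>j / b\<^sub>j\<close>, a little of the \<open>a\<close>-weight can be moved from \<open>j\<close> to \<open>i\<close> and
  a little of the \<open>b\<close>-weight from \<open>i\<close> to \<open>j\<close> so that no coordinate of the strategy
  increases. Player 1's strategies are nonnegative, so the payoff does not increase either.
  An optimal strategy to which no such exchange applies has its \<open>a\<close>-weights on \<open>{..m}\<close> and
  its \<open>b\<close>-weights on \<open>{m..}\<close> for some \<open>m\<close>, which is the claimed equation.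
\<close>

section \<open>Player 2's strategies and their weights\<close>

definition prob_simplex :: "(real ^ 'n::finite) set" where
  "prob_simplex = {\<theta>. (\<forall>i. 0 \<le> \<theta> $ i) \<and> (\<Sum>i\<in>UNIV. \<theta> $ i) = 1}"

text \<open>The two weight vectors are kept as arguments because \<open>y\<close> alone need not
  determine them, while exchanges act on the weights.\<close>

definition mixture :: "real ^ 'n \<Rightarrow> real ^ 'n \<Rightarrow> real ^ 'n \<Rightarrow> real ^ 'n \<Rightarrow> real ^ 'n::finite" where
  "mixture a b \<theta> \<phi> = (\<chi> i. \<theta> $ i * a $ i + \<phi> $ i * b $ i)"

lemma compact_prob_simplex: "compact (prob_simplex :: (real ^ 'n::finite) set)"
proof -
  have "\<theta> $ i \<le> 1" if "\<theta> \<in> prob_simplex" for \<theta> :: "real ^ 'n" and i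
    using that member_le_sum[of i UNIV "\<lambda>i. \<theta> $ i"] by (simp add: prob_simplex_def)
  then have "prob_simplex \<subseteq> (cbox 0 1 :: (real ^ 'n) set)"
    by (auto simp: mem_box_cart prob_simplex_def)
  then have "bounded (prob_simplex :: (real ^ 'n) set)"
    by (rule bounded_subset[OF bounded_cbox])
  moreover have "closed (prob_simplex :: (real ^ 'n) set)"
    unfolding prob_simplex_def Collect_conj_eq
    by (intro closed_Int closed_Collect_all closed_Collect_le closed_Collect_eq continuous_intros)
  ultimately show ?thesis
    by (simp add: compact_eq_bounded_closed)
qed

lemma axis_mem_prob_simplex: "axis i 1 \<in> prob_simplex"
  by (auto simp: prob_simplex_def axis_def)

text \<open>Replacing weight functions by weight vectors makes the topology of
  \<open>real ^ 'n\<close> available.\<close>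

lemma weighted_simplex_eq:
  "weighted_simplex w = (\<lambda>\<theta>. \<chi> i. \<theta> $ i * w $ i) ` prob_simplex"
proof -
  have *: "(\<Sum>i\<in>UNIV. (\<theta> i * w $ i) *\<^sub>R axis i 1) = (\<chi> i. \<theta> i * w $ i)" for \<theta>
    by (simp add: vec_eq_iff axis_def if_distrib cong: if_cong)
  show ?thesis
  proof (intro subset_antisym subsetI)
    fix y assume "y \<in> weighted_simplex w"
    then obtain \<theta> where \<theta>: "\<forall>i. 0 \<le> \<theta> i" "sum \<theta> UNIV = 1" "y = (\<chi> i. \<theta> i * w $ i)"
      unfolding weighted_simplex_def * by auto
    then show "y \<in> (\<lambda>\<theta>. \<chi> i. \<theta> $ i * w $ i) ` prob_simplex"
      by (intro image_eqI[of _ _ "\<chi> i. \<theta> i"]) (auto simp: prob_simplex_def)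
  next
    fix y assume "y \<in> (\<lambda>\<theta>. \<chi> i. \<theta> $ i * w $ i) ` prob_simplex"
    then show "y \<in> weighted_simplex w"
      unfolding weighted_simplex_def * by (auto simp: prob_simplex_def)
  qed
qed

text \<open>This presents Player 2's strategy set as a continuous image of a compact product, and it
  gives each strategy weights that can be exchanged.\<close>

lemma weighted_simplex_plus_eq:
  "weighted_simplex a + weighted_simplex b =
    (\<lambda>(\<theta>, \<phi>). mixture a b \<theta> \<phi>) ` (prob_simplex \<times> prob_simplex)"
proof -
  have "mixture a b \<theta> \<phi> = (\<chi> i. \<theta> $ i * a $ i) + (\<chi> i. \<phi> $ i * b $ i)" for \<theta> \<phi>
    by (simp add: mixture_def vec_eq_iff)
  then show ?thesis
    by (auto simp: weighted_simplex_eq set_plus_def)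
qed

lemma compact_weighted_simplex_plus:
  "compact (weighted_simplex a + weighted_simplex b)"
  unfolding weighted_simplex_plus_eq mixture_def case_prod_beta
  by (intro compact_continuous_image continuous_intros compact_Times compact_prob_simplex)

lemma weighted_simplex_plus_nonempty: "weighted_simplex a + weighted_simplex b \<noteq> {}"
  unfolding weighted_simplex_plus_eq using axis_mem_prob_simplex by blast

section \<open>Existence and monotonicity of optimal strategies\<close>

lemma bounded_polymatroid_base: "bounded (polymatroid_base f)"
proof (rule bounded_subset)
  have "x $ i \<le> f {i}" if "x \<in> polymatroid_base f" for x i
  proof -
    have "(\<Sum>i\<in>{i}. x $ i) \<le> f {i}"
      using that unfolding polymatroid_base_def by blast
    then show ?thesis by simp
  qed
  then show "polymatroid_base f \<subseteq> cbox 0 (\<chi> i. f {i})"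
    by (auto simp: mem_box_cart polymatroid_base_def)
qed (rule bounded_cbox)

lemma bdd_above_inner_image:
  assumes "bounded X"
  shows "bdd_above ((\<lambda>x. x \<bullet> y) ` X)"
  by (intro bounded_imp_bdd_above bounded_linear_image assms bounded_linear_inner_left)

text \<open>A finite supremum of linear functions is convex, and a finite convex function on the
  whole space is continuous. For empty \<open>X\<close> the supremum is a constant default
  value.\<close>

lemma continuous_on_Sup_inner:
  fixes X :: "'a::euclidean_space set"
  assumes "bounded X"
  shows "continuous_on UNIV (\<lambda>y. SUP x\<in>X. x \<bullet> y)"
proof (cases "X = {}")
  case False
  have "convex_on UNIV (\<lambda>y. SUP x\<in>X. x \<bullet> y)"
  proof (rule convex_onI)
    fix t :: real and y z :: 'a
    assume t: "0 < t" "t < 1"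
    show "(SUP x\<in>X. x \<bullet> ((1 - t) *\<^sub>R y + t *\<^sub>R z))
        \<le> (1 - t) * (SUP x\<in>X. x \<bullet> y) + t * (SUP x\<in>X. x \<bullet> z)"
      unfolding inner_add_right inner_scaleR_right using t
      by (intro cSUP_least False add_mono mult_left_mono cSUP_upper bdd_above_inner_image assms)
         auto
  qed simp
  then show ?thesis
    by (intro convex_on_continuous) auto
qed simp

lemma optimal_minimizer_exists:
  assumes "bounded X" "compact Y" "Y \<noteq> {}"
  shows "\<exists>y. optimal_minimizer X Y y"
  using continuous_attains_inf[OF assms(2,3)
      continuous_on_subset[OF continuous_on_Sup_inner[OF assms(1)] subset_UNIV]]
  unfolding optimal_minimizer_def by blast

text \<open>The payoff against a nonnegative \<open>x\<close> is monotone in \<open>y\<close>, so a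
  strategy dominated by an optimal one cannot do worse.\<close>

lemma optimal_minimizer_decrease:
  fixes X :: "(real ^ 'n::finite) set"
  assumes "bounded X" "\<And>x. x \<in> X \<Longrightarrow> 0 \<le> x"
    and "optimal_minimizer X Y y" "y' \<in> Y" "y' \<le> y"
  shows "optimal_minimizer X Y y'"
proof -
  have "(SUP x\<in>X. x \<bullet> y') \<le> (SUP x\<in>X. x \<bullet> y)"
  proof (cases "X = {}")
    case False
    have "x \<bullet> y' \<le> x \<bullet> y" if "x \<in> X" for x
      using assms(2)[OF that] assms(5)
      by (auto simp: inner_vec_def less_eq_vec_def intro!: sum_mono mult_left_mono)
    then show ?thesis
      using False assms(1) by (intro cSUP_mono bdd_above_inner_image) auto
  qed simp
  then show ?thesis
    using assms(3,4) unfolding optimal_minimizer_def by (meson order_trans)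
qed

section \<open>Sorted weights: the exchange argument and the resulting equation\<close>

lemma exchange_mem_prob_simplex:
  assumes "\<theta> \<in> prob_simplex" "0 \<le> \<epsilon>" "\<epsilon> \<le> \<theta> $ j"
  shows "\<theta> + \<epsilon> *\<^sub>R (axis i 1 - axis j 1) \<in> prob_simplex"
proof -
  let ?\<theta> = "\<theta> + \<epsilon> *\<^sub>R (axis i 1 - axis j 1)"
  have "(\<Sum>k\<in>UNIV. ?\<theta> $ k) =
      (\<Sum>k\<in>UNIV. \<theta> $ k + \<epsilon> * (axis i 1 $ k - axis j 1 $ k))"
    by simp
  also have "\<dots> = (\<Sum>k\<in>UNIV. \<theta> $ k)"
    unfolding sum.distrib sum_distrib_left[symmetric] sum_subtractf by (simp add: axis_def)
  finally show ?thesis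
    using assms by (auto simp: prob_simplex_def axis_def)
qed

text \<open>Instead of iterating exchanges and proving termination, minimize a potential over the
  compact set of weight pairs whose mixture is dominated by the given one. An exchange still
  possible at the minimizer would lower the potential further.\<close>

lemma sorted_mixture_exists:
  fixes a b :: "real ^ 'n::{finite,linorder}"
  assumes a_pos: "\<And>i. 0 < a $ i"
    and b_pos: "\<And>i. 0 < b $ i"
    and a_mono: "\<And>i j. i \<le> j \<Longrightarrow> a $ i \<le> a $ j"
    and b_antimono: "\<And>i j. i \<le> j \<Longrightarrow> b $ j \<le> b $ i"
    and "\<theta>\<^sub>0 \<in> prob_simplex" "\<phi>\<^sub>0 \<in> prob_simplex"
  obtains \<theta> \<phi> where "\<theta> \<in> prob_simplex" "\<phi> \<in> prob_simplex"
    "mixture a b \<theta> \<phi> \<le> mixture a b \<theta>\<^sub>0 \<phi>\<^sub>0"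
    "\<And>i j. i < j \<Longrightarrow> \<theta> $ j = 0 \<or> \<phi> $ i = 0"
proof -
  define K where "K = (prob_simplex \<times> prob_simplex) \<inter>
    {p. \<forall>i. mixture a b (fst p) (snd p) $ i \<le> mixture a b \<theta>\<^sub>0 \<phi>\<^sub>0 $ i}"
  \<comment> \<open>\<open>r\<close> is the rank in the linear order. The potential \<open>G\<close>
    charges \<open>a\<close>-weight on high ranks and rewards \<open>b\<close>-weight there, so it
    favours sorted weights.\<close>
  define r where "r i = real (card {..i})" for i :: 'n
  define G where "G p = (\<Sum>i\<in>UNIV. r i * (fst p $ i - snd p $ i))" for p
  have "compact K"
    unfolding K_def mixture_def
    by (intro compact_Int_closed compact_Times compact_prob_simplex closed_Collect_all
        closed_Collect_le continuous_intros)
  moreover have "(\<theta>\<^sub>0, \<phi>\<^sub>0) \<in> K"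
    using assms by (simp add: K_def)
  moreover have "continuous_on K G"
    unfolding G_def by (intro continuous_intros)
  ultimately obtain p where p: "p \<in> K" "\<And>q. q \<in> K \<Longrightarrow> G p \<le> G q"
    using continuous_attains_inf[of K G] by blast
  obtain \<theta> \<phi> where p_eq: "p = (\<theta>, \<phi>)"
    by fastforce
  have mem: "\<theta> \<in> prob_simplex" "\<phi> \<in> prob_simplex"
    and le: "mixture a b \<theta> \<phi> \<le> mixture a b \<theta>\<^sub>0 \<phi>\<^sub>0"
    using p(1) by (auto simp: K_def p_eq less_eq_vec_def)
  have "\<theta> $ j = 0 \<or> \<phi> $ i = 0" if "i < j" for i j
  proof (rule ccontr)
    assume "\<not> ?thesis"
    then have pos: "0 < \<theta> $ j" "0 < \<phi> $ i"
      using mem by (auto simp: prob_simplex_def order_less_le)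
    \<comment> \<open>The amounts moved, \<open>t * b $ i\<close> of \<open>a\<close>-weight and
      \<open>t * a $ i\<close> of \<open>b\<close>-weight, leave coordinate \<open>i\<close> of the
      mixture unchanged. This \<open>t\<close> is the largest that keeps both weights
      nonnegative.\<close>
    define t where "t = min (\<theta> $ j / b $ i) (\<phi> $ i / a $ i)"
    have t: "0 < t" "t * b $ i \<le> \<theta> $ j" "t * a $ i \<le> \<phi> $ i"
      using pos a_pos[of i] b_pos[of i] by (auto simp: t_def min_def field_simps)
    define \<theta>' where "\<theta>' = \<theta> + (t * b $ i) *\<^sub>R (axis i 1 - axis j 1)"
    define \<phi>' where "\<phi>' = \<phi> + (t * a $ i) *\<^sub>R (axis j 1 - axis i 1)"
    have ta: "0 < t * a $ i" and tb: "0 < t * b $ i"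
      using t(1) a_pos b_pos by auto
    have mem': "\<theta>' \<in> prob_simplex" "\<phi>' \<in> prob_simplex"
      unfolding \<theta>'_def \<phi>'_def using mem t ta tb
      by (auto intro!: exchange_mem_prob_simplex)
    \<comment> \<open>The left side is what coordinate \<open>j\<close> gains, the right side what
      it loses.\<close>
    have "t * a $ i * b $ j \<le> t * b $ i * a $ j"
      using t(1) mult_mono[OF a_mono[of i j] b_antimono[of i j]] that a_pos b_pos
      by (simp add: mult.assoc mult.commute[of "b $ i"] less_imp_le)
    then have "mixture a b \<theta>' \<phi>' $ k \<le> mixture a b \<theta> \<phi> $ k" for k
      using that by (auto simp: mixture_def \<theta>'_def \<phi>'_def axis_def algebra_simps)
    then have "(\<theta>', \<phi>') \<in> K"
      using mem' le by (fastforce simp: K_def less_eq_vec_def intro: order_trans)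
    from p(2)[OF this] have "G (\<theta>, \<phi>) \<le> G (\<theta>', \<phi>')"
      by (simp add: p_eq)
    \<comment> \<open>Both moves change \<open>G\<close> in the same direction:
      \<open>a\<close>-weight goes down in rank, and \<open>b\<close>-weight, which enters
      negatively, goes up.\<close>
    moreover have "G (\<theta>', \<phi>') = G (\<theta>, \<phi>) + (t * a $ i + t * b $ i) * (r i - r j)"
    proof -
      have "G (\<theta>', \<phi>') = (\<Sum>k\<in>UNIV. r k * (\<theta> $ k - \<phi> $ k)
          + (t * a $ i + t * b $ i) * (r k * axis i 1 $ k - r k * axis j 1 $ k))"
        unfolding G_def \<theta>'_def \<phi>'_def by (intro sum.cong) (simp_all add: algebra_simps)
      also have "\<dots> = G (\<theta>, \<phi>) + (t * a $ i + t * b $ i) * (r i - r j)"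
        unfolding G_def sum.distrib sum_distrib_left[symmetric] sum_subtractf
        by (simp add: axis_def if_distrib cong: if_cong)
      finally show ?thesis .
    qed
    moreover have "r i < r j"
      unfolding r_def using that by (intro psubset_card_mono less_imp_of_nat_less) auto
    ultimately show False
      using ta tb by (smt (verit) mult_pos_neg)
  qed
  then show ?thesis
    using that mem le by blast
qed

text \<open>Take \<open>m\<close> to be the last index carrying \<open>a\<close>-weight; sortedness
  then puts all \<open>b\<close>-weight at or after \<open>m\<close>. Only at \<open>m\<close> can
  the two kinds meet, and the terms \<open>\<phi> $ m * b $ m\<close> from the two sums
  cancel.\<close>

lemma sorted_mixture_equation:
  fixes a b :: "real ^ 'n::{finite,linorder}"
  assumes a_pos: "\<And>i. 0 < a $ i"
    and b_pos: "\<And>i. 0 < b $ i"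
    and mem: "\<theta> \<in> prob_simplex" "\<phi> \<in> prob_simplex"
    and sorted: "\<And>i j. i < j \<Longrightarrow> \<theta> $ j = 0 \<or> \<phi> $ i = 0"
  defines "y \<equiv> mixture a b \<theta> \<phi>"
  shows "\<exists>m. a $ m * (\<Sum>i\<in>{..m}. y $ i / a $ i) + b $ m * (\<Sum>i\<in>{m<..}. y $ i / b $ i)
    = a $ m + b $ m"
proof -
  define m where "m = Max {i. \<theta> $ i \<noteq> 0}"
  have "{i. \<theta> $ i \<noteq> 0} \<noteq> {}"
  proof
    assume "{i. \<theta> $ i \<noteq> 0} = {}"
    then show False
      using mem(1) by (simp add: prob_simplex_def)
  qed
  then have m: "\<theta> $ m \<noteq> 0" and \<theta>0: "\<And>i. m < i \<Longrightarrow> \<theta> $ i = 0"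
    using Max_in[of "{i. \<theta> $ i \<noteq> 0}"] Max_ge[of "{i. \<theta> $ i \<noteq> 0}"]
    by (auto simp: m_def leD)
  have \<phi>0: "\<phi> $ i = 0" if "i < m" for i
    using sorted[OF that] m by blast
  have nz: "a $ i \<noteq> 0" "b $ i \<noteq> 0" for i
    using a_pos[of i] b_pos[of i] by auto
  have split: "sum g UNIV = sum g {..m} + sum g {m<..}" for g :: "'n \<Rightarrow> real"
    by (subst sum.union_disjoint[symmetric]) (auto intro!: sum.cong)
  \<comment> \<open>Up to \<open>m\<close> the quotients recover the \<open>a\<close>-weights,
    except that the \<open>b\<close>-weight at \<open>m\<close> is also counted, in units of
    \<open>a $ m\<close>.\<close>
  have "(\<Sum>i\<in>{..m}. y $ i / a $ i) = (\<Sum>i\<in>{..m}. \<theta> $ i + (if i = m then \<phi> $ m * b $ m / a $ m else 0))"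
    using \<phi>0 nz by (intro sum.cong) (auto simp: y_def mixture_def add_divide_distrib order_less_le)
  also have "\<dots> = (\<Sum>i\<in>{..m}. \<theta> $ i) + \<phi> $ m * b $ m / a $ m"
    by (simp add: sum.distrib)
  also have "(\<Sum>i\<in>{..m}. \<theta> $ i) = 1"
    using mem(1) split[of "($) \<theta>"] \<theta>0 by (simp add: prob_simplex_def)
  finally have 1: "(\<Sum>i\<in>{..m}. y $ i / a $ i) = 1 + \<phi> $ m * b $ m / a $ m" .
  have "(\<Sum>i\<in>{m<..}. y $ i / b $ i) = (\<Sum>i\<in>{m<..}. \<phi> $ i)"
    using \<theta>0 nz by (intro sum.cong) (auto simp: y_def mixture_def)
  moreover have "(\<Sum>i\<in>{..m}. \<phi> $ i) = \<phi> $ m"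
    using \<phi>0 by (subst sum.mono_neutral_right[of _ "{m}"]) (auto simp: order_less_le)
  ultimately have 2: "(\<Sum>i\<in>{m<..}. y $ i / b $ i) = 1 - \<phi> $ m"
    using mem(2) split[of "($) \<phi>"] by (simp add: prob_simplex_def)
  show ?thesis
    using nz[of m] by (intro exI[of _ m]) (simp add: 1 2 field_simps)
qed

theorem mainTheorem4:
  fixes f :: "'n::{finite,linorder} set \<Rightarrow> real"
    and a b :: "real ^ 'n::{finite,linorder}"
  assumes f_nonneg: "\<And>S. 0 \<le> f S"
    and f_mono: "mono f"
    and f_submodular: "submodular f"
    and f_empty: "f {} = 0"
    and a_pos: "\<And>i. 0 < a $ i"
    and b_pos: "\<And>i. 0 < b $ i"
    and a_mono: "\<And>i j. i \<le> j \<Longrightarrow> a $ i \<le> a $ j"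
    and b_antimono: "\<And>i j. i \<le> j \<Longrightarrow> b $ j \<le> b $ i"
  shows "\<exists>y. optimal_minimizer (polymatroid_base f) (weighted_simplex a + weighted_simplex b) y \<and>
    (\<exists>m. a $ m * (\<Sum>i\<in>{..m}. y $ i / a $ i) + b $ m * (\<Sum>i\<in>{m<..}. y $ i / b $ i) = a $ m + b $ m)"
proof -
  let ?X = "polymatroid_base f" and ?Y = "weighted_simplex a + weighted_simplex b"
  obtain y\<^sub>0 where opt: "optimal_minimizer ?X ?Y y\<^sub>0"
    using optimal_minimizer_exists[OF bounded_polymatroid_base compact_weighted_simplex_plus
        weighted_simplex_plus_nonempty] by blast
  then have "y\<^sub>0 \<in> ?Y"
    by (simp add: optimal_minimizer_def)
  then obtain \<theta>\<^sub>0 \<phi>\<^sub>0 where y\<^sub>0: "\<theta>\<^sub>0 \<in> prob_simplex" "\<phi>\<^sub>0 \<in> prob_simplex" "y\<^sub>0 = mixture a b \<theta>\<^sub>0 \<phi>\<^sub>0"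
    unfolding weighted_simplex_plus_eq by auto
  \<comment> \<open>Sorting the weights of \<open>y\<^sub>0\<close> yields a strategy below it in
    every coordinate, which is therefore still optimal.\<close>
  obtain \<theta> \<phi> where mem: "\<theta> \<in> prob_simplex" "\<phi> \<in> prob_simplex"
    and le: "mixture a b \<theta> \<phi> \<le> y\<^sub>0"
    and sorted: "\<And>i j. i < j \<Longrightarrow> \<theta> $ j = 0 \<or> \<phi> $ i = 0"
    unfolding y\<^sub>0(3)
    using sorted_mixture_exists[OF a_pos b_pos a_mono b_antimono y\<^sub>0(1,2)] by blast
  have "mixture a b \<theta> \<phi> \<in> ?Y"
    using mem unfolding weighted_simplex_plus_eq by auto
  then have "optimal_minimizer ?X ?Y (mixture a b \<theta> \<phi>)"
    by (intro optimal_minimizer_decrease[OF bounded_polymatroid_base _ opt _ le])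
       (simp_all add: polymatroid_base_def less_eq_vec_def)
  then show ?thesis
    using sorted_mixture_equation[OF a_pos b_pos mem sorted] by blast
qed

end
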